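(* Let $(\bar X,\bar\sigma)$ be an infinite, minimal, linearly recurrent one-sided shift with recurrence constant $K$. Then every endomorphism of $(\bar X,\bar\sigma)$ is a $k$-th root of a power of the shift for some positive integer $k\le 2(K+1)(2K+3)^2$; that is, for every endomorphism $\bar\Phi$ there are a positive integer $k\le 2(K+1)(2K+3)^2$ and an integer $n\ge 0$ with $\bar\Phi^k=\bar\sigma^n$.
   Context: $\mathcal A$ is a finite alphabet; a one-sided shift is a closed shift-invariant subset $\bar X$ of $\mathcal A^{\mathbb N_0}$ (product topology) with the shift map $\bar\sigma$. Its language $\mathcal L_{\bar X}$ is the set of finite words occurring in points of $\bar X$, and $\ell(u)$ denotes the length of a word $u$. An endomorphism of $(\bar X,\bar\sigma)$ is a continuous onto map $\bar X\to\bar X$ commuting with $\bar\sigma$. For $u,w\in\mathcal L_{\bar X}$, $w$ is a return word to $u$ if (a) $u$ is a prefix of $w$, (b) $wu\in\mathcal L_{\bar X}$, and (c) there are exactly two occurrences of $u$ in $wu$. A minimal shift is linearly recurrent with recurrence constant $K$ if for any word $u$ in its language and any return word $w$ to $u$, $\ell(w)\le K\ell(u)$. *)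

theory Defs
  imports "HOL-Analysis.Analysis" "HOL-Library.Sublist"
begin

definition full_shift_topology :: "'a set \<Rightarrow> (nat \<Rightarrow> 'a) topology" where
  "full_shift_topology A = product_topology (\<lambda>_. discrete_topology A) UNIV"

definition shift_map :: "(nat \<Rightarrow> 'a) \<Rightarrow> nat \<Rightarrow> 'a" where
  "shift_map x = (\<lambda>i. x (Suc i))"

text \<open>Invariance is taken as forward invariance, so a shift need not be mapped
  onto itself. For minimal shifts the two readings agree.\<close>

definition one_sided_shift :: "'a set \<Rightarrow> (nat \<Rightarrow> 'a) set \<Rightarrow> bool" where
  "one_sided_shift A X \<longleftrightarrow>
     finite A \<and> closedin (full_shift_topology A) X \<and> shift_map ` X \<subseteq> X"

definition minimal_shift :: "'a set \<Rightarrow> (nat \<Rightarrow> 'a) set \<Rightarrow> bool" where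
  "minimal_shift A X \<longleftrightarrow>
     one_sided_shift A X \<and> X \<noteq> {} \<and>
     (\<forall>Y. one_sided_shift A Y \<and> Y \<subseteq> X \<and> Y \<noteq> {} \<longrightarrow> Y = X)"

definition language :: "(nat \<Rightarrow> 'a) set \<Rightarrow> 'a list set" where
  "language X = {map x [i..<i + n] | x i n. x \<in> X}"

text \<open>The set of positions at which \<open>u\<close> occurs in the finite word \<open>v\<close>;
  occurrences may overlap.\<close>

definition occurrences :: "'a list \<Rightarrow> 'a list \<Rightarrow> nat set" where
  "occurrences u v = {i. i + length u \<le> length v \<and> take (length u) (drop i v) = u}"

definition return_word :: "(nat \<Rightarrow> 'a) set \<Rightarrow> 'a list \<Rightarrow> 'a list \<Rightarrow> bool" where
  "return_word X u w \<longleftrightarrow>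
     u \<in> language X \<and> w \<in> language X \<and>
     prefix u w \<and> w @ u \<in> language X \<and> card (occurrences u (w @ u)) = 2"

text \<open>The empty word has to be excluded: every one-letter word of the language is a return word
  to it, which would require \<open>1 \<le> K * 0\<close>.\<close>

definition linearly_recurrent :: "'a set \<Rightarrow> (nat \<Rightarrow> 'a) set \<Rightarrow> real \<Rightarrow> bool" where
  "linearly_recurrent A X K \<longleftrightarrow>
     minimal_shift A X \<and>
     (\<forall>u w. u \<in> language X \<and> u \<noteq> [] \<and> return_word X u w \<longrightarrow>
        real (length w) \<le> K * real (length u))"

text \<open>Only the values of \<open>\<Phi>\<close> on \<open>X\<close> are relevant.\<close>

definition shift_endomorphism ::
    "'a set \<Rightarrow> (nat \<Rightarrow> 'a) set \<Rightarrow> ((nat \<Rightarrow> 'a) \<Rightarrow> nat \<Rightarrow> 'a) \<Rightarrow> bool" where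
  "shift_endomorphism A X \<Phi> \<longleftrightarrow>
     continuous_map (subtopology (full_shift_topology A) X)
                    (subtopology (full_shift_topology A) X) \<Phi> \<and>
     \<Phi> ` X = X \<and>
     (\<forall>x\<in>X. \<Phi> (shift_map x) = shift_map (\<Phi> x))"

end

theory Submission
  imports Defs
begin

text \<open>The shift map of an infinite minimal shift is onto but not injective. Call a point with at
  least two preimages a branch point. Linear recurrence gives \<open>p n \<le> K n\<close> for the word complexity,
  while \<open>m\<close> branch points force \<open>p (n + 1) - p n \<ge> m\<close> for large \<open>n\<close>; so there are
  at most \<open>K\<close> branch points.

  Endomorphisms are almost injective: \<open>\<Phi> a = \<Phi> b\<close> implies that \<open>a\<close> and \<open>b\<close> agree from
  some position on which does not depend on \<open>a\<close> and \<open>b\<close>. Indeed, the kernels of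
  \<open>\<Phi>, \<Phi>\<^sup>2, \<Phi>\<^sup>3, \<dots>\<close> increase, and they can be read off finite sets
  of pairs of long words whose size is bounded in terms of \<open>K\<close> alone, so they become stationary.

  Now take the two branches at a branch point and follow them far back in time, ending in points
  \<open>a\<close> and \<open>b\<close>. They are never identified by small powers \<open>\<Phi>\<^sup>j\<close>, so the forward orbit of each
  \<open>\<Phi>\<^sup>j a\<close> meets a branch point. By the pigeonhole principle \<open>\<Phi>\<^sup>i a\<close> and \<open>\<Phi>\<^sup>j a\<close>
  reach the same one for some \<open>i < j\<close>, where \<open>j\<close> is at most the number of branch points, and
  by minimality the resulting relation between \<open>\<Phi>\<^bsup>j - i\<^esup>\<close> and the shift holds on the
  whole space.\<close>

section \<open>Words and compactness\<close>

definition pre :: "nat \<Rightarrow> (nat \<Rightarrow> 'a) \<Rightarrow> 'a list" where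
  "pre n x = map x [0..<n]"

lemma length_pre [simp]: "length (pre n x) = n"
  by (simp add: pre_def)

lemma pre_0 [simp]: "pre 0 x = []"
  by (simp add: pre_def)

lemma pre_Suc: "pre (Suc n) x = pre n x @ [x n]"
  by (simp add: pre_def)

lemma pre_eq_iff: "pre n x = pre n y \<longleftrightarrow> (\<forall>s<n. x s = y s)"
  by (auto simp: pre_def list_eq_iff_nth_eq)

lemma pre_eq_mono: "pre n x = pre n y \<Longrightarrow> m \<le> n \<Longrightarrow> pre m x = pre m y"
  by (simp add: pre_eq_iff)

lemma set_pre: "set (pre n x) \<subseteq> range x"
  by (auto simp: pre_def)

lemma pre_add: "\<exists>v. pre (n + m) x = pre n x @ v"
  by (induction m) (auto simp: pre_Suc)

lemma tl_pre_Suc: "tl (pre (Suc n) x) = pre n (shift_map x)"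
  by (rule nth_equalityI) (auto simp: pre_def shift_map_def nth_tl simp del: upt_Suc)

lemma shift_map_funpow: "(shift_map ^^ m) x i = x (i + m)"
  by (induction m arbitrary: i) (simp_all add: shift_map_def)

lemma eventually_inj_on_pre:
  assumes "finite F"
  shows "eventually (\<lambda>m. inj_on (pre m) F) sequentially"
proof -
  have "eventually (\<lambda>m. pre m x = pre m y \<longrightarrow> x = y) sequentially" for x y :: "nat \<Rightarrow> 'a"
  proof (cases "x = y")
    case False
    then obtain d where "x d \<noteq> y d" by blast
    then have "\<forall>m\<ge>Suc d. pre m x = pre m y \<longrightarrow> x = y"
      by (auto simp: pre_eq_iff)
    then show ?thesis unfolding eventually_sequentially by blast
  qed simp
  then have "eventually (\<lambda>m. \<forall>x\<in>F. \<forall>y\<in>F. pre m x = pre m y \<longrightarrow> x = y) sequentially"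
    using assms by (intro eventually_ball_finite ballI) auto
  then show ?thesis by (simp add: inj_on_def)
qed

text \<open>If every \<open>a\<close> failed at some \<open>k a\<close>, all of them would fail at
  the sum of the \<open>k a\<close>. This exchange of quantifiers drives the compactness
  arguments.\<close>

lemma finite_antimono_choice:
  fixes R :: "'b \<Rightarrow> nat \<Rightarrow> bool"
  assumes "finite S" and ex: "\<And>n. \<exists>a\<in>S. R a n"
    and anti: "\<And>a m n. R a n \<Longrightarrow> m \<le> n \<Longrightarrow> R a m"
  shows "\<exists>a\<in>S. \<forall>n. R a n"
proof (rule ccontr)
  assume "\<not> ?thesis"
  then have "\<forall>a\<in>S. \<exists>n. \<not> R a n" by blast
  then obtain k where k: "\<And>a. a \<in> S \<Longrightarrow> \<not> R a (k a)" by metis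
  obtain a where a: "a \<in> S" "R a (sum k S)" using ex by blast
  have "k a \<le> sum k S" using a \<open>finite S\<close> by (simp add: member_le_sum)
  then show False using a k anti by blast
qed

text \<open>Letters are appended one at a time, keeping the invariant \<open>Q u\<close> that
  \<open>u\<close> has extensions in \<open>P\<close> of every length; among finitely many letters
  one always preserves it.\<close>

lemma koenig:
  assumes "finite A" and len: "\<And>n. \<exists>u\<in>P. length u = n"
    and alph: "\<And>u. u \<in> P \<Longrightarrow> set u \<subseteq> A"
    and pref: "\<And>u v. u @ v \<in> P \<Longrightarrow> u \<in> P"
  shows "\<exists>x. \<forall>n. pre n x \<in> P"
proof -
  define Q where "Q u \<longleftrightarrow> (\<forall>n. \<exists>v. length v = n \<and> u @ v \<in> P)" for u
  have "\<exists>a. Q (u @ [a])" if Qu: "Q u" for u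
  proof -
    have "\<exists>a\<in>A. \<forall>n. \<exists>v. length v = n \<and> u @ [a] @ v \<in> P"
    proof (rule finite_antimono_choice[OF \<open>finite A\<close>])
      fix n
      obtain v where v: "length v = Suc n" "u @ v \<in> P" using Qu unfolding Q_def by blast
      then obtain a v' where "v = a # v'" by (cases v) auto
      then show "\<exists>a\<in>A. \<exists>v. length v = n \<and> u @ [a] @ v \<in> P"
        using v alph[OF v(2)] by auto
    next
      fix a m n assume "\<exists>v. length v = n \<and> u @ [a] @ v \<in> P" "m \<le> n"
      then obtain v where v: "length v = n" "u @ [a] @ v \<in> P" by blast
      have "(u @ [a] @ take m v) @ drop m v \<in> P" using v by simp
      from pref[OF this] show "\<exists>v. length v = m \<and> u @ [a] @ v \<in> P"
        using v \<open>m \<le> n\<close> by (intro exI[of _ "take m v"]) auto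
    qed
    then show ?thesis by (auto simp: Q_def)
  qed
  then obtain e where e: "\<And>u. Q u \<Longrightarrow> Q (u @ [e u])" by metis
  define f where "f = rec_nat [] (\<lambda>_ u. u @ [e u])"
  have Qf: "Q (f n)" for n
  proof (induction n)
    case 0
    show ?case using len by (auto simp: f_def Q_def)
  next
    case (Suc n)
    then show ?case using e by (simp add: f_def)
  qed
  have "f n = pre n (\<lambda>i. e (f i))" for n
    by (induction n) (simp_all add: f_def pre_Suc)
  moreover have "f n \<in> P" for n using Qf[of n] by (auto simp: Q_def dest: spec[of _ 0])
  ultimately show ?thesis by metis
qed

text \<open>\<open>C + 1\<close> strict inclusions would push the cardinality up to at least
  \<open>C + 1\<close>.\<close>

lemma incseq_card_bounded_stable:
  fixes T :: "nat \<Rightarrow> 'b set"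
  assumes fin: "\<And>i. i \<le> Suc C \<Longrightarrow> finite (T i)"
    and card: "\<And>i. i \<le> Suc C \<Longrightarrow> card (T i) \<le> C"
    and mono: "\<And>i. i \<le> C \<Longrightarrow> T i \<subseteq> T (Suc i)"
  shows "\<exists>i\<le>C. T i = T (Suc i)"
proof (rule ccontr)
  assume "\<not> ?thesis"
  then have psub: "T i \<subset> T (Suc i)" if "i \<le> C" for i using mono that by blast
  have "i \<le> card (T i)" if "i \<le> Suc C" for i
    using that
  proof (induction i)
    case (Suc i)
    have "card (T i) < card (T (Suc i))"
      using Suc.prems psub[of i] fin by (intro psubset_card_mono) auto
    then show ?case using Suc by simp
  qed simp
  then show False using card[of "Suc C"] by fastforce
qed

section \<open>Complexity and branch points\<close>

text \<open>The topology is replaced by prefixes, and linear recurrence by \<open>rec\<close>: every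
  word of length \<open>n\<close> begins at one of the positions from \<open>t\<close> to
  \<open>t + c * n - 1\<close>, wherever the window is placed.\<close>

locale recurrent_shift =
  fixes A :: "'a set" and X :: "(nat \<Rightarrow> 'a) set" and c :: real
  assumes finite_A: "finite A"
    and in_A: "x \<in> X \<Longrightarrow> x i \<in> A"
    and closed: "(\<And>n. \<exists>y\<in>X. pre n y = pre n x) \<Longrightarrow> x \<in> X"
    and shift: "x \<in> X \<Longrightarrow> shift_map x \<in> X"
    and infinite_X: "infinite X"
    and rec: "x \<in> X \<Longrightarrow> z \<in> X \<Longrightarrow> 0 < n \<Longrightarrow>
      \<exists>j\<ge>t. real j + 1 \<le> real t + c * real n \<and> pre n ((shift_map ^^ j) x) = pre n z"
begin

lemma shift_pow: "x \<in> X \<Longrightarrow> (shift_map ^^ m) x \<in> X"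
  by (induction m) (auto simp: shift)

abbreviation words :: "nat \<Rightarrow> 'a list set" where "words n \<equiv> pre n ` X"

lemma finite_words: "finite (words n)"
proof (rule finite_subset)
  show "words n \<subseteq> {xs. set xs \<subseteq> A \<and> length xs = n}"
    using in_A set_pre by fastforce
qed (simp add: finite_lists_length_eq finite_A)

lemma card_words_le:
  assumes "0 < n"
  shows "real (card (words n)) \<le> c * real n"
proof -
  obtain x where x: "x \<in> X" using infinite_X by fastforce
  let ?m = "nat \<lfloor>c * real n\<rfloor>"
  have "words n \<subseteq> (\<lambda>j. pre n ((shift_map ^^ j) x)) ` {..<?m}"
  proof
    fix w assume "w \<in> words n"
    then obtain z where z: "z \<in> X" "w = pre n z" by blast
    obtain j where j: "real j + 1 \<le> c * real n" "pre n ((shift_map ^^ j) x) = pre n z"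
      using rec[OF x z(1) assms, of 0] by auto
    have "j < ?m" using j(1) by linarith
    then show "w \<in> (\<lambda>j. pre n ((shift_map ^^ j) x)) ` {..<?m}" using j z by (metis imageI lessThan_iff)
  qed
  then have "card (words n) \<le> ?m"
    by (metis card_lessThan finite_lessThan surj_card_le)
  \<comment> \<open>As there are words, \<open>?m\<close> is positive, so \<open>nat\<close> has not
    truncated a negative number.\<close>
  moreover have "0 < card (words n)" using x finite_words by (auto simp: card_gt_0_iff)
  ultimately show ?thesis by linarith
qed

lemma card_letters_ge: "2 \<le> card (words 1)"
proof (rule ccontr)
  assume "\<not> ?thesis"
  then have "card (words 1) \<le> Suc 0" by simp
  then have one: "u = v" if "u \<in> words 1" "v \<in> words 1" for u v
    using that card_le_Suc0_iff_eq[OF finite_words[of 1]] by blast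
  have "x = y" if "x \<in> X" "y \<in> X" for x y
  proof
    fix i
    have "pre 1 ((shift_map ^^ i) x) = pre 1 ((shift_map ^^ i) y)"
      by (rule one) (use that shift_pow in auto)
    then show "x i = y i" by (simp add: pre_eq_iff shift_map_funpow)
  qed
  moreover obtain x where "x \<in> X" using infinite_X by fastforce
  ultimately have "X \<subseteq> {x}" by blast
  then have "finite X" by (rule finite_subset) simp
  then show False using infinite_X by simp
qed

lemma c_ge_2: "2 \<le> c"
  using card_letters_ge card_words_le[of 1] by simp

lemma rec0:
  assumes "x \<in> X" "z \<in> X"
  shows "\<exists>j\<ge>t. pre n ((shift_map ^^ j) x) = pre n z"
  by (cases "n = 0") (use rec[OF assms, of n t] in auto)

section \<open>Preimages under the shift and compactness\<close>

lemma case_nat_in_X: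
  assumes "\<And>n. \<exists>x\<in>X. x 0 = a \<and> pre n (shift_map x) = pre n z"
  shows "case_nat a z \<in> X"
proof (rule closed)
  fix n
  obtain x where x: "x \<in> X" "x 0 = a" "pre n (shift_map x) = pre n z" using assms by blast
  then have "pre n x = pre n (case_nat a z)"
    by (auto simp: pre_eq_iff shift_map_def split: nat.split)
  then show "\<exists>y\<in>X. pre n y = pre n (case_nat a z)" using x by blast
qed

lemma shift_map_case_nat [simp]: "shift_map (case_nat a z) = z"
  by (simp add: shift_map_def)

text \<open>Each prefix of \<open>z\<close> recurs in \<open>z\<close> at a positive position and so
  has a letter to its left. One letter serves all lengths, and it can be put in front of
  \<open>z\<close>.\<close>

lemma shift_onto:
  assumes "z \<in> X"
  shows "\<exists>x\<in>X. shift_map x = z"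
proof -
  have "\<exists>a\<in>A. \<forall>n. \<exists>x\<in>X. x 0 = a \<and> pre n (shift_map x) = pre n z"
  proof (rule finite_antimono_choice[OF finite_A])
    fix n
    obtain j where j: "j \<ge> 1" "pre n ((shift_map ^^ j) z) = pre n z"
      using rec0[OF assms assms] by blast
    then have "pre n (shift_map ((shift_map ^^ (j - 1)) z)) = pre n z"
      by (cases j) auto
    then show "\<exists>a\<in>A. \<exists>x\<in>X. x 0 = a \<and> pre n (shift_map x) = pre n z"
      using in_A shift_pow[OF assms] by blast
  qed (meson pre_eq_mono)
  then obtain a where "case_nat a z \<in> X" using case_nat_in_X by blast
  then show ?thesis by (intro bexI[of _ "case_nat a z"]) auto
qed

lemma shift_pow_onto: "z \<in> X \<Longrightarrow> \<exists>x\<in>X. (shift_map ^^ m) x = z"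
proof (induction m arbitrary: z)
  case (Suc m)
  then obtain y where "y \<in> X" "shift_map y = z" using shift_onto by blast
  with Suc.IH[of y] show ?case by auto
qed auto

lemma pre_koenig:
  assumes ex: "\<And>n. \<exists>x\<in>X. R n x"
    and mono: "\<And>m n x. R n x \<Longrightarrow> m \<le> n \<Longrightarrow> R m x"
  shows "\<exists>z\<in>X. \<forall>n. \<exists>x\<in>X. R n x \<and> pre n x = pre n z"
proof -
  have "\<exists>z. \<forall>n. pre n z \<in> {pre n x | n x. x \<in> X \<and> R n x}"
  proof (rule koenig[OF finite_A])
    show "\<exists>u\<in>{pre n x | n x. x \<in> X \<and> R n x}. length u = n" for n
      using ex[of n] by fastforce
    show "set u \<subseteq> A" if "u \<in> {pre n x | n x. x \<in> X \<and> R n x}" for u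
      using that in_A set_pre by fastforce
    show "u \<in> {pre n x | n x. x \<in> X \<and> R n x}"
      if uv: "u @ v \<in> {pre n x | n x. x \<in> X \<and> R n x}" for u v
    proof -
      obtain n x where nx: "u @ v = pre n x" "x \<in> X" "R n x" using uv by blast
      then have le: "length u \<le> n" by (metis length_pre length_append le_add1)
      moreover have "u = pre (length u) x"
        using nx(1) pre_add[of "length u" "n - length u" x] le by auto
      ultimately show ?thesis using nx mono by blast
    qed
  qed
  then obtain z where z: "\<And>n. pre n z \<in> {pre n x | n x. x \<in> X \<and> R n x}" by blast
  have "\<exists>x\<in>X. R n x \<and> pre n x = pre n z" for n
  proof -
    obtain m x where "pre n z = pre m x" "x \<in> X" "R m x" using z[of n] by blast
    moreover from this have "n = m" by (metis length_pre)
    ultimately show ?thesis by auto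
  qed
  moreover from this have "z \<in> X" by (intro closed) blast
  ultimately show ?thesis by blast
qed

text \<open>By compactness: otherwise pairs with different values that agree on longer and longer
  prefixes accumulate at some \<open>z\<close>, near which \<open>f\<close> is constant.\<close>

lemma uniformly_locally_constant:
  assumes "\<And>z. z \<in> X \<Longrightarrow> \<exists>n. \<forall>x\<in>X. pre n x = pre n z \<longrightarrow> f x = f z"
  shows "\<exists>n. \<forall>x\<in>X. \<forall>y\<in>X. pre n x = pre n y \<longrightarrow> f x = f y"
proof (rule ccontr)
  assume "\<not> ?thesis"
  then have "\<exists>x\<in>X. \<exists>y\<in>X. pre n x = pre n y \<and> f x \<noteq> f y" for n by blast
  then have "\<exists>z\<in>X. \<forall>n. \<exists>x\<in>X. (\<exists>y\<in>X. pre n x = pre n y \<and> f x \<noteq> f y) \<and> pre n x = pre n z"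
    by (intro pre_koenig) (blast dest: pre_eq_mono)+
  then obtain z where z: "z \<in> X"
    "\<And>n. \<exists>x\<in>X. \<exists>y\<in>X. pre n x = pre n y \<and> f x \<noteq> f y \<and> pre n x = pre n z" by blast
  then show False using assms[OF z(1)] by metis
qed

section \<open>Branch points and the growth of complexity\<close>

definition branch :: "(nat \<Rightarrow> 'a) set" where
  "branch = {z. \<exists>x\<in>X. \<exists>y\<in>X. x \<noteq> y \<and> shift_map x = z \<and> shift_map y = z}"

text \<open>If different letters can precede arbitrarily long common words, a limit is a branch
  point. Otherwise some \<open>n\<close> letters determine the letter on their left, hence
  arbitrarily long words to their left, which leaves room for finitely many points only.\<close>

lemma branch_nonempty: "branch \<noteq> {}"
proof (cases "\<forall>n. \<exists>x\<in>X. \<exists>y\<in>X. pre n (shift_map x) = pre n (shift_map y) \<and> x 0 \<noteq> y 0")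
  case True
  define R where "R n z \<longleftrightarrow> (\<exists>x\<in>X. \<exists>y\<in>X. shift_map x = z \<and> pre n (shift_map y) = pre n z \<and> x 0 \<noteq> y 0)"
    for n z
  have "\<exists>z\<in>X. \<forall>n. \<exists>x\<in>X. R n x \<and> pre n x = pre n z"
  proof (rule pre_koenig)
    show "\<exists>z\<in>X. R n z" for n using True shift unfolding R_def by metis
    show "R m z" if "R n z" "m \<le> n" for m n z
      using that unfolding R_def by (meson pre_eq_mono)
  qed
  then obtain z where z: "z \<in> X" "\<And>n. \<exists>x\<in>X. R n x \<and> pre n x = pre n z" by blast
  have "\<exists>p\<in>A \<times> A. \<forall>n. fst p \<noteq> snd p \<and> (\<exists>x\<in>X. x 0 = fst p \<and> pre n (shift_map x) = pre n z) \<and>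
      (\<exists>x\<in>X. x 0 = snd p \<and> pre n (shift_map x) = pre n z)"
  proof (rule finite_antimono_choice)
    fix n
    obtain x y where "x \<in> X" "y \<in> X" "pre n (shift_map x) = pre n z"
      "pre n (shift_map y) = pre n z" "x 0 \<noteq> y 0"
      using z(2)[of n] unfolding R_def by metis
    then show "\<exists>p\<in>A \<times> A. fst p \<noteq> snd p \<and> (\<exists>x\<in>X. x 0 = fst p \<and> pre n (shift_map x) = pre n z) \<and>
      (\<exists>x\<in>X. x 0 = snd p \<and> pre n (shift_map x) = pre n z)"
      using in_A by (intro bexI[of _ "(x 0, y 0)"]) auto
  next
    fix p m n
    assume "fst p \<noteq> snd p \<and> (\<exists>x\<in>X. x 0 = fst p \<and> pre n (shift_map x) = pre n z) \<and>
      (\<exists>x\<in>X. x 0 = snd p \<and> pre n (shift_map x) = pre n z)" and "m \<le> n"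
    then show "fst p \<noteq> snd p \<and> (\<exists>x\<in>X. x 0 = fst p \<and> pre m (shift_map x) = pre m z) \<and>
      (\<exists>x\<in>X. x 0 = snd p \<and> pre m (shift_map x) = pre m z)"
      using pre_eq_mono[OF _ \<open>m \<le> n\<close>] by blast
  qed (simp add: finite_A)
  then obtain p where p: "\<forall>n. fst p \<noteq> snd p \<and> (\<exists>x\<in>X. x 0 = fst p \<and> pre n (shift_map x) = pre n z) \<and>
      (\<exists>x\<in>X. x 0 = snd p \<and> pre n (shift_map x) = pre n z)"
    by (rule bexE)
  define a b where "a = fst p" and "b = snd p"
  have "a \<noteq> b" using p by (simp add: a_def b_def)
  moreover have "case_nat a z \<in> X" "case_nat b z \<in> X"
    by (intro case_nat_in_X; use p in \<open>simp add: a_def b_def\<close>)+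
  moreover have "case_nat a z \<noteq> case_nat b z"
    using \<open>a \<noteq> b\<close> by (auto dest: fun_cong[where x = 0])
  ultimately have "z \<in> branch" unfolding branch_def mem_Collect_eq
    by (intro bexI[of _ "case_nat a z"] bexI[of _ "case_nat b z"]) simp_all
  then show ?thesis by blast
next
  case False
  then obtain n where n: "\<And>x y. x \<in> X \<Longrightarrow> y \<in> X \<Longrightarrow> pre n (shift_map x) = pre n (shift_map y) \<Longrightarrow> x 0 = y 0"
    by blast
  have extend_left: "pre n ((shift_map ^^ m) x) = pre n ((shift_map ^^ m) y) \<Longrightarrow> pre (m + n) x = pre (m + n) y"
    if "x \<in> X" "y \<in> X" for m x y
    using that
  proof (induction m arbitrary: x y)
    case (Suc m)
    have IH: "pre (m + n) (shift_map x) = pre (m + n) (shift_map y)"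
      by (rule Suc.IH) (use Suc.prems shift in \<open>simp_all add: funpow_swap1\<close>)
    then have "x 0 = y 0" using n Suc.prems pre_eq_mono by (metis le_add2)
    show ?case unfolding pre_eq_iff
    proof (intro allI impI)
      fix s assume "s < Suc m + n"
      then show "x s = y s" using IH \<open>x 0 = y 0\<close>
        by (cases s) (auto simp: pre_eq_iff shift_map_def)
    qed
  qed simp
  \<comment> \<open>\<open>F\<close> has more points than there are words of length
    \<open>n\<close>, and \<open>m\<close> will be large enough to tell the points of
    \<open>F\<close> apart by their prefixes.\<close>
  obtain F where F: "F \<subseteq> X" "finite F" "card F = Suc (card (words n))"
    using infinite_arbitrarily_large[OF infinite_X] by blast
  obtain m where m: "inj_on (pre m) F"
    using eventually_inj_on_pre[OF F(2)] by (auto simp: eventually_sequentially)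
  have "inj_on (\<lambda>x. pre n ((shift_map ^^ m) x)) F"
  proof (rule inj_onI)
    fix x y assume xy: "x \<in> F" "y \<in> F" "pre n ((shift_map ^^ m) x) = pre n ((shift_map ^^ m) y)"
    then have "pre (m + n) x = pre (m + n) y" using extend_left F by blast
    then have "pre m x = pre m y" by (rule pre_eq_mono) simp
    then show "x = y" using m xy by (auto dest: inj_onD)
  qed
  then have "card F \<le> card (words n)"
    by (rule card_inj_on_le) (use F shift_pow finite_words in auto)
  then show ?thesis using F by simp
qed

text \<open>Deleting the first letter maps \<open>words (Suc n)\<close> onto \<open>words n\<close>.
  \<open>g\<close> chooses one left extension of each word, and \<open>h\<close> a second one for
  each prefix of a point of \<open>F\<close>.\<close>

lemma card_words_Suc_ge:
  assumes "F \<subseteq> branch" "finite F" "inj_on (pre n) F"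
  shows "card (words n) + card F \<le> card (words (Suc n))"
proof -
  have "\<exists>w\<in>words (Suc n). tl w = v" if "v \<in> words n" for v
    using that shift_onto by (metis (no_types, lifting) image_iff tl_pre_Suc)
  then obtain g where g: "\<And>v. v \<in> words n \<Longrightarrow> g v \<in> words (Suc n) \<and> tl (g v) = v" by metis
  have "\<exists>w\<in>words (Suc n). tl w = pre n z \<and> w \<noteq> g (pre n z)" if zF: "z \<in> F" for z
  proof -
    obtain x y where xy: "x \<in> X" "y \<in> X" "x \<noteq> y" "shift_map x = z" "shift_map y = z"
      using zF assms(1) unfolding branch_def by blast
    have tails: "x (Suc t) = y (Suc t)" for t
      using xy(4,5) by (auto simp: shift_map_def dest: fun_cong[where x = t])
    have "x 0 \<noteq> y 0"
    proof
      assume "x 0 = y 0"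
      then have "x s = y s" for s using tails by (cases s) auto
      then show False using xy by blast
    qed
    then have "pre (Suc n) x \<noteq> pre (Suc n) y" by (auto simp: pre_eq_iff)
    then show ?thesis using xy by (metis imageI tl_pre_Suc)
  qed
  then obtain h where h: "\<And>z. z \<in> F \<Longrightarrow> h z \<in> words (Suc n) \<and> tl (h z) = pre n z \<and> h z \<noteq> g (pre n z)"
    by metis
  have "inj_on g (words n)" using g by (metis inj_onI)
  moreover have "inj_on h F" using h assms(3) by (metis inj_onD inj_onI)
  moreover have "g ` words n \<inter> h ` F = {}" using g h by fastforce
  ultimately have "card (words n) + card F = card (g ` words n \<union> h ` F)"
    using assms(2) finite_words by (subst card_Un_disjoint) (auto simp: card_image)
  also have "\<dots> \<le> card (words (Suc n))"
    using g h finite_words by (intro card_mono) auto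
  finally show ?thesis .
qed

lemma card_branch_subset:
  assumes "F \<subseteq> branch" "finite F"
  shows "real (card F) \<le> c"
proof (rule ccontr)
  assume "\<not> ?thesis"
  then have gt: "real (card F) - c > 0" by simp
  obtain n0 where n0: "\<And>n. n \<ge> n0 \<Longrightarrow> inj_on (pre n) F"
    using eventually_inj_on_pre[OF assms(2)] by (auto simp: eventually_sequentially)
  have grow: "k * card F \<le> card (words (n0 + k))" for k
  proof (induction k)
    case (Suc k)
    then show ?case using card_words_Suc_ge[OF assms n0[of "n0 + k"]] by simp
  qed simp
  obtain k where k: "real k * (real (card F) - c) > c * real n0"
    using reals_Archimedean3[OF gt] by blast
  have "c * real n0 \<ge> 0" using c_ge_2 by simp
  then have "0 < k" using k by (cases k) auto
  then have "real (k * card F) \<le> c * real (n0 + k)"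
    using grow[of k] card_words_le[of "n0 + k"] by linarith
  then show False using k by (simp add: algebra_simps)
qed

lemma finite_branch: "finite branch" and card_branch: "real (card branch) \<le> c"
proof -
  have "\<forall>F. F \<subseteq> branch \<longrightarrow> finite F \<longrightarrow> card F \<le> nat \<lfloor>c\<rfloor>"
    using card_branch_subset by (simp add: le_nat_floor)
  then show *: "finite branch" using finite_if_finite_subsets_card_bdd by blast
  show "real (card branch) \<le> c" using card_branch_subset * by blast
qed

section \<open>Spacing of occurrences\<close>

definition N :: nat where "N = nat \<lceil>c\<rceil>"

lemma recN:
  assumes "x \<in> X" "z \<in> X" "0 < n"
  shows "\<exists>j\<ge>t. j < t + N * n \<and> pre n ((shift_map ^^ j) x) = pre n z"
proof -
  obtain j where j: "j \<ge> t" "real j + 1 \<le> real t + c * real n" "pre n ((shift_map ^^ j) x) = pre n z"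
    using rec[OF assms] by blast
  have "c * real n \<le> real N * real n"
    unfolding N_def by (intro mult_right_mono) (auto simp: real_nat_ceiling_ge)
  then have "real j < real (t + N * n)" using j(2) by simp
  then have "j < t + N * n" by linarith
  then show ?thesis using j by blast
qed

text \<open>A single branch point makes the complexity grow at each step (the Morse-Hedlund
  bound).\<close>

lemma card_words_gt: "n < card (words n)"
proof (induction n)
  case 0
  have "words 0 \<noteq> {}" using infinite_X by auto
  then show ?case using finite_words[of 0] by (metis card_gt_0_iff)
next
  case (Suc n)
  obtain z where "z \<in> branch" using branch_nonempty by blast
  then show ?case using card_words_Suc_ge[of "{z}" n] Suc by simp
qed

text \<open>A distance \<open>g \<le> l\<close> would create a stretch of period \<open>g\<close>.
  The factor \<open>N + 1\<close> leaves room for \<open>N * l\<close> starting positions plus the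
  length \<open>l\<close>, hence for all words of length \<open>l\<close>, of which there are more
  than \<open>l\<close>.\<close>

lemma occurrence_gap:
  assumes y: "y \<in> X" and "i < j" and le: "(N + 1) * l \<le> n"
    and eq: "pre n ((shift_map ^^ i) y) = pre n ((shift_map ^^ j) y)"
  shows "l < j - i"
proof (rule ccontr)
  assume "\<not> ?thesis"
  define g where "g = j - i"
  define x where "x = (shift_map ^^ i) y"
  have g: "0 < g" "g \<le> l" using \<open>\<not> l < j - i\<close> \<open>i < j\<close> by (auto simp: g_def)
  have x: "x \<in> X" using y shift_pow by (simp add: x_def)
  have shift_g: "x s = x (s + g)" if "s < n" for s
  proof -
    have "y (s + i) = y (s + j)" using eq that by (simp add: pre_eq_iff shift_map_funpow)
    moreover have "s + j = s + g + i" using \<open>i < j\<close> by (simp add: g_def)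
    ultimately show ?thesis by (simp add: x_def shift_map_funpow)
  qed
  have per: "x s = x (s mod g)" if "s < n" for s
    using that
  proof (induction s rule: less_induct)
    case (less s)
    show ?case
    proof (cases "s < g")
      case False
      then have "x (s - g) = x s" using shift_g[of "s - g"] less.prems by simp
      moreover have "x (s - g) = x ((s - g) mod g)" using less False g by simp
      ultimately show ?thesis using False by (simp add: le_mod_geq)
    qed simp
  qed
  \<comment> \<open>A stretch of period \<open>g\<close> that is long enough to contain all words of length \<open>l\<close> shows that
    there are at most \<open>g\<close> of them.\<close>
  have "words l \<subseteq> (\<lambda>t. pre l ((shift_map ^^ t) x)) ` {..<g}"
  proof
    fix w assume "w \<in> words l"
    then obtain z where z: "z \<in> X" "w = pre l z" by blast
    obtain t where t: "t < N * l" "pre l ((shift_map ^^ t) x) = pre l z"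
      using recN[OF x z(1), of l 0] g by auto
    have "pre l ((shift_map ^^ (t mod g)) x) = pre l ((shift_map ^^ t) x)"
      unfolding pre_eq_iff shift_map_funpow
    proof (intro allI impI)
      fix s assume "s < l"
      then have lt: "s + t < n" using t(1) le by (simp add: algebra_simps)
      moreover have "t mod g \<le> t" by simp
      ultimately have "s + t mod g < n" by linarith
      then have "x (s + t mod g) = x ((s + t mod g) mod g)" by (rule per)
      also have "\<dots> = x (s + t)" using per[OF lt] by (simp add: mod_add_right_eq)
      finally show "x (s + t mod g) = x (s + t)" .
    qed
    then show "w \<in> (\<lambda>t. pre l ((shift_map ^^ t) x)) ` {..<g}"
      using t z g by (intro image_eqI[of _ _ "t mod g"]) auto
  qed
  then have "card (words l) \<le> g" by (metis card_lessThan finite_lessThan surj_card_le)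
  then show False using card_words_gt[of l] g by simp
qed

lemma occurrence_unique:
  assumes "y \<in> X" "0 < l" "(N + 1) * l \<le> n" "i div l = j div l"
    and "pre n ((shift_map ^^ i) y) = pre n ((shift_map ^^ j) y)"
  shows "i = j"
proof -
  have less: "\<not> i < j" if "i div l = j div l"
    and "pre n ((shift_map ^^ i) y) = pre n ((shift_map ^^ j) y)" for i j
  proof
    assume "i < j"
    then have "l < j - i" using occurrence_gap assms that by blast
    moreover have "i = j div l * l + i mod l" "j = j div l * l + j mod l"
      by (metis that(1) div_mult_mod_eq) simp
    moreover have "j mod l < l" using \<open>0 < l\<close> by simp
    ultimately show False by linarith
  qed
  show ?thesis using less[OF assms(4,5)] less[OF assms(4,5)[symmetric]] by linarith
qed

end

section \<open>Endomorphisms\<close>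

text \<open>Continuity takes the form of a block code: \<open>r + 1\<close> letters determine one
  letter of the image, so each application of \<open>\<Phi>\<close> costs \<open>r\<close> letters
  of a known prefix.\<close>

locale recurrent_shift_endomorphism = recurrent_shift +
  fixes \<Phi> :: "(nat \<Rightarrow> 'a) \<Rightarrow> nat \<Rightarrow> 'a" and r :: nat
  assumes onto: "\<Phi> ` X = X"
    and commute: "x \<in> X \<Longrightarrow> \<Phi> (shift_map x) = shift_map (\<Phi> x)"
    and local: "x \<in> X \<Longrightarrow> y \<in> X \<Longrightarrow> pre (Suc r) x = pre (Suc r) y \<Longrightarrow> \<Phi> x 0 = \<Phi> y 0"
begin

lemma Phi_pow_in: "x \<in> X \<Longrightarrow> (\<Phi> ^^ j) x \<in> X"
  by (induction j) (use onto in auto)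

lemma Phi_pow_onto: "(\<Phi> ^^ j) ` X = X"
proof (induction j)
  case (Suc j)
  have "(\<Phi> ^^ Suc j) ` X = \<Phi> ` (\<Phi> ^^ j) ` X" by (simp add: image_comp)
  then show ?case using Suc onto by simp
qed simp

lemma Phi_shift_pow: "x \<in> X \<Longrightarrow> \<Phi> ((shift_map ^^ m) x) = (shift_map ^^ m) (\<Phi> x)"
  by (induction m) (simp_all add: commute shift_pow)

lemma Phi_pow_shift_pow: "x \<in> X \<Longrightarrow> (\<Phi> ^^ j) ((shift_map ^^ m) x) = (shift_map ^^ m) ((\<Phi> ^^ j) x)"
  by (induction j) (simp_all add: Phi_shift_pow Phi_pow_in)

lemma pre_Phi:
  assumes "x \<in> X" "y \<in> X" "pre (n + r) x = pre (n + r) y"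
  shows "pre n (\<Phi> x) = pre n (\<Phi> y)"
  unfolding pre_eq_iff
proof (intro allI impI)
  fix s assume "s < n"
  then have "pre (Suc r) ((shift_map ^^ s) x) = pre (Suc r) ((shift_map ^^ s) y)"
    using assms(3) by (simp add: pre_eq_iff shift_map_funpow)
  then have "\<Phi> ((shift_map ^^ s) x) 0 = \<Phi> ((shift_map ^^ s) y) 0"
    using local shift_pow assms by blast
  then show "\<Phi> x s = \<Phi> y s" using assms by (simp add: Phi_shift_pow shift_map_funpow)
qed

lemma pre_Phi_pow:
  assumes "x \<in> X" "y \<in> X" "pre (n + j * r) x = pre (n + j * r) y"
  shows "pre n ((\<Phi> ^^ j) x) = pre n ((\<Phi> ^^ j) y)"
  using assms(3)
proof (induction j arbitrary: n)
  case (Suc j)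
  then have "pre (n + r) ((\<Phi> ^^ j) x) = pre (n + r) ((\<Phi> ^^ j) y)"
    by (intro Suc.IH) (simp add: algebra_simps)
  then show ?case using pre_Phi Phi_pow_in assms by simp
qed simp

section \<open>Almost injectivity of endomorphisms\<close>

text \<open>Finite approximations \<open>T i\<close> to the kernels of \<open>\<Phi> ^^ i\<close>
  increase with bounded size, so two consecutive ones coincide. Lifting \<open>a\<close> and
  \<open>b\<close> along \<open>\<Phi> ^^ i\<close> then shows that they agree on stretches which
  together cover all positions from \<open>N * n\<close> on.\<close>

lemma Phi_eq_imp_tail_eq:
  "\<exists>m. \<forall>a\<in>X. \<forall>b\<in>X. \<Phi> a = \<Phi> b \<longrightarrow> (shift_map ^^ m) a = (shift_map ^^ m) b"
proof -
  \<comment> \<open>\<open>D\<close> is the number of blocks of length \<open>l\<close> among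
    \<open>N * L\<close> positions, since \<open>L = (N + 1) * (N + 1) * l\<close>. It does not
    involve \<open>r\<close>, so \<open>C\<close> can be fixed before \<open>l\<close>.\<close>
  define D where "D = N * (N + 1) * (N + 1)"
  define C where "C = D * D"
  \<comment> \<open>Applying \<open>\<Phi>\<close> up to \<open>Suc C\<close> times costs fewer than
    \<open>l\<close> letters.\<close>
  define l where "l = Suc (Suc C * r)"
  define n where "n = (N + 1) * l"
  define L where "L = (N + 1) * n"
  have l: "0 < l" by (simp add: l_def)
  have n: "0 < n" using l by (simp add: n_def)
  \<comment> \<open>After this loss a prefix of length \<open>L\<close> keeps at least
    \<open>n\<close> letters, to locate occurrences, and at least \<open>N * n\<close>, to bridge
    the gaps between occurrences of \<open>u\<close>.\<close>
  have Lr: "i * r \<le> L \<and> n \<le> L - i * r \<and> N * n \<le> L - i * r" if "i \<le> Suc C" for i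
  proof -
    have "i * r \<le> Suc C * r" using that by (intro mult_right_mono) auto
    then have ir: "i * r \<le> l" by (simp add: l_def)
    have "l \<le> n" by (simp add: n_def)
    moreover have "0 < N" using c_ge_2 by (simp add: N_def)
    then have "n \<le> N * n" by simp
    ultimately have "n + i * r \<le> L" "N * n + i * r \<le> L" "i * r \<le> L" using ir
      unfolding L_def add_mult_distrib by linarith+
    then show ?thesis by linarith
  qed
  obtain z where z: "z \<in> X" using infinite_X by fastforce
  define u where "u = pre n z"
  \<comment> \<open>This is the kernel of \<open>\<Phi> ^^ i\<close> as seen on words of length
    \<open>L\<close>, with the first word anchored at \<open>u\<close>. By
    \<open>pre_Phi_pow\<close> the condition on the images depends only on the two words.\<close>
  define T where "T i = {(pre L x, pre L y) | x y. x \<in> X \<and> y \<in> X \<and> pre n x = u \<and>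
    pre (L - i * r) ((\<Phi> ^^ i) x) = pre (L - i * r) ((\<Phi> ^^ i) y)}" for i
  have "0 < L" using n by (simp add: L_def)
  then have "\<exists>j. j < N * L \<and> pre L ((shift_map ^^ j) z) = w" if "w \<in> words L" for w
    using that recN[OF z, of _ L 0] by auto
  then obtain f where f: "\<And>w. w \<in> words L \<Longrightarrow> f w < N * L \<and> pre L ((shift_map ^^ f w) z) = w"
    by metis
  have fdiv: "f w div l < D" if "w \<in> words L" for w
    using f[OF that] by (intro less_mult_imp_div_less) (simp add: L_def n_def D_def algebra_simps)
  \<comment> \<open>Occurrences in \<open>z\<close> of words beginning with \<open>u\<close> are more than \<open>l\<close> apart, and so are
    occurrences of words with the same image under \<open>\<Phi>\<^sup>i\<close>. Hence the blocks of length \<open>l\<close>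
    in which they start identify them.\<close>
  have inj: "inj_on (\<lambda>(w, w'). (f w div l, f w' div l)) (T i)" if i: "i \<le> Suc C" for i
  proof (rule inj_onI, clarify)
    fix w1 w1' w2 w2'
    assume "(w1, w1') \<in> T i" "(w2, w2') \<in> T i"
      and d: "f w1 div l = f w2 div l" and d': "f w1' div l = f w2' div l"
    then obtain x1 y1 x2 y2 where
      1: "w1 = pre L x1" "w1' = pre L y1" "x1 \<in> X" "y1 \<in> X" "pre n x1 = u"
         "pre (L - i * r) ((\<Phi> ^^ i) x1) = pre (L - i * r) ((\<Phi> ^^ i) y1)"
      and 2: "w2 = pre L x2" "w2' = pre L y2" "x2 \<in> X" "y2 \<in> X" "pre n x2 = u"
         "pre (L - i * r) ((\<Phi> ^^ i) x2) = pre (L - i * r) ((\<Phi> ^^ i) y2)"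
      unfolding T_def by blast
    have f1: "pre L ((shift_map ^^ f w1) z) = pre L x1" and f2: "pre L ((shift_map ^^ f w2) z) = pre L x2"
      and f1': "pre L ((shift_map ^^ f w1') z) = pre L y1" and f2': "pre L ((shift_map ^^ f w2') z) = pre L y2"
      using f 1 2 by auto
    have "n \<le> L" by (simp add: L_def)
    then have "pre n ((shift_map ^^ f w1) z) = pre n ((shift_map ^^ f w2) z)"
      using pre_eq_mono[OF f1] pre_eq_mono[OF f2] 1 2 by simp
    then have "f w1 = f w2" 
      by (intro occurrence_unique[OF z l _ d]) (simp_all only: n_def order_refl)
    then have w: "w1 = w2" using f1 f2 1 2 by simp
    have Phi_z: "pre (L - i * r) ((shift_map ^^ t) ((\<Phi> ^^ i) z)) = pre (L - i * r) ((\<Phi> ^^ i) y)"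
      if "pre L ((shift_map ^^ t) z) = pre L y" "y \<in> X" for t y
      using pre_Phi_pow[of "(shift_map ^^ t) z" y "L - i * r" i] that z Lr[OF i]
      by (simp add: shift_pow Phi_pow_shift_pow)
    \<comment> \<open>Both second words share the image of the common first word, so uniqueness is
      applied to occurrences in \<open>(\<Phi> ^^ i) z\<close> instead of \<open>z\<close>.\<close>
    have "pre (L - i * r) ((\<Phi> ^^ i) x1) = pre (L - i * r) ((\<Phi> ^^ i) x2)"
      using pre_Phi_pow[of x1 x2 "L - i * r" i] 1 2 w Lr[OF i] by simp
    then have "pre (L - i * r) ((shift_map ^^ f w1') ((\<Phi> ^^ i) z)) =
        pre (L - i * r) ((shift_map ^^ f w2') ((\<Phi> ^^ i) z))"
      using Phi_z[OF f1'] Phi_z[OF f2'] 1 2 by simp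
    then have "f w1' = f w2'"
      using Lr[OF i] by (intro occurrence_unique[OF Phi_pow_in[OF z] l _ d']) (auto simp: n_def)
    then show "w1 = w2 \<and> w1' = w2'" using w f1' f2' 1 2 by simp
  qed
  have T_words: "T i \<subseteq> words L \<times> words L" for i by (auto simp: T_def)
  have "card (T i) \<le> C" if "i \<le> Suc C" for i
  proof -
    have "card (T i) \<le> card ({..<D} \<times> {..<D})"
    proof (rule card_inj_on_le[OF inj[OF that]])
      show "(\<lambda>(w, w'). (f w div l, f w' div l)) ` T i \<subseteq> {..<D} \<times> {..<D}"
      proof safe
        fix w w' assume "(w, w') \<in> T i"
        then have "w \<in> words L" "w' \<in> words L" using T_words[of i] by blast+
        then show "f w div l < D" "f w' div l < D" using fdiv by blast+
      qed
    qed simp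
    then show ?thesis by (simp add: C_def)
  qed
  moreover have "finite (T i)" for i
    by (rule finite_subset[OF T_words]) (simp add: finite_words)
  moreover have "T i \<subseteq> T (Suc i)" if "i \<le> C" for i
  proof -
    \<comment> \<open>Subtraction does not truncate here because
      \<open>Suc i * r \<le> L\<close>.\<close>
    have eq: "L - i * r = L - Suc i * r + r" using Lr[of "Suc i"] that by simp
    have "pre (L - Suc i * r) ((\<Phi> ^^ Suc i) x) = pre (L - Suc i * r) ((\<Phi> ^^ Suc i) y)"
      if "x \<in> X" "y \<in> X" "pre (L - i * r) ((\<Phi> ^^ i) x) = pre (L - i * r) ((\<Phi> ^^ i) y)" for x y
    proof -
      have "pre (L - Suc i * r + r) ((\<Phi> ^^ i) x) = pre (L - Suc i * r + r) ((\<Phi> ^^ i) y)"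
        using that(3) by (simp only: eq[symmetric])
      from pre_Phi[OF Phi_pow_in[OF that(1)] Phi_pow_in[OF that(2)] this] show ?thesis
        unfolding funpow.simps comp_apply .
    qed
    then show ?thesis unfolding T_def by blast
  qed
  ultimately obtain i where i: "i \<le> C" "T i = T (Suc i)"
    using incseq_card_bounded_stable[of C T] by blast
  have "(shift_map ^^ (N * n)) a = (shift_map ^^ (N * n)) b"
    if ab: "a \<in> X" "b \<in> X" "\<Phi> a = \<Phi> b" for a b
  proof -
    have "a \<in> (\<Phi> ^^ i) ` X" "b \<in> (\<Phi> ^^ i) ` X" using ab by (simp_all only: Phi_pow_onto)
    then obtain x y where xy: "x \<in> X" "y \<in> X" "a = (\<Phi> ^^ i) x" "b = (\<Phi> ^^ i) y"
      by (elim imageE)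
    have "a s = b s" if s: "N * n \<le> s" for s
    proof -
      \<comment> \<open>The window of \<open>N * n\<close> starting positions is placed so as to end
        at \<open>s\<close>; thus \<open>t \<le> s < t + N * n\<close>.\<close>
      obtain t where t: "t \<ge> s + 1 - N * n" "t < s + 1 - N * n + N * n" "pre n ((shift_map ^^ t) x) = u"
        using recN[OF xy(1) z n] unfolding u_def by blast
      have ts: "t \<le> s" "s - t < N * n" using s t by linarith+
      let ?x = "(shift_map ^^ t) x" and ?y = "(shift_map ^^ t) y"
      have X: "?x \<in> X" "?y \<in> X" using xy shift_pow by auto
      have "(\<Phi> ^^ Suc i) ?x = (\<Phi> ^^ Suc i) ?y"
        using ab xy by (simp add: Phi_pow_shift_pow Phi_shift_pow)
      then have "(pre L ?x, pre L ?y) \<in> T (Suc i)"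
        unfolding T_def mem_Collect_eq using X t by (intro exI[of _ ?x] exI[of _ ?y]) simp
      then have "(pre L ?x, pre L ?y) \<in> T i" using i by simp
      then obtain x' y' where x'y': "pre L ?x = pre L x'" "pre L ?y = pre L y'" "x' \<in> X" "y' \<in> X"
        "pre (L - i * r) ((\<Phi> ^^ i) x') = pre (L - i * r) ((\<Phi> ^^ i) y')"
        unfolding T_def mem_Collect_eq prod.inject by auto
      have "i * r \<le> L" using Lr[of i] i by simp
      then have "pre (L - i * r) ((\<Phi> ^^ i) ?x) = pre (L - i * r) ((\<Phi> ^^ i) x')"
        "pre (L - i * r) ((\<Phi> ^^ i) ?y) = pre (L - i * r) ((\<Phi> ^^ i) y')"
        using pre_Phi_pow[OF X(1) x'y'(3), of "L - i * r" i] pre_Phi_pow[OF X(2) x'y'(4), of "L - i * r" i]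
          x'y'(1,2) by simp_all
      then have "pre (L - i * r) ((shift_map ^^ t) a) = pre (L - i * r) ((shift_map ^^ t) b)"
        using x'y' xy by (simp add: Phi_pow_shift_pow)
      moreover have "s - t < L - i * r" using ts Lr[of i] i by simp
      ultimately show "a s = b s" using ts by (auto simp: pre_eq_iff shift_map_funpow)
    qed
    then show ?thesis by (simp add: fun_eq_iff shift_map_funpow)
  qed
  then show ?thesis by blast
qed

text \<open>One factor \<open>\<Phi>\<close> is cancelled at a time, at the cost of \<open>m\<close>
  shifts each; \<open>J * m\<close> shifts suffice for all \<open>j \<le> J\<close>.\<close>

lemma Phi_pow_eq_imp_tail_eq:
  "\<exists>m. \<forall>j\<le>J. \<forall>a\<in>X. \<forall>b\<in>X. (\<Phi> ^^ j) a = (\<Phi> ^^ j) b \<longrightarrow> (shift_map ^^ m) a = (shift_map ^^ m) b"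
proof -
  obtain m where m: "\<And>a b. a \<in> X \<Longrightarrow> b \<in> X \<Longrightarrow> \<Phi> a = \<Phi> b \<Longrightarrow> (shift_map ^^ m) a = (shift_map ^^ m) b"
    using Phi_eq_imp_tail_eq by blast
  have pow: "(shift_map ^^ (j * m)) a = (shift_map ^^ (j * m)) b"
    if "a \<in> X" "b \<in> X" "(\<Phi> ^^ j) a = (\<Phi> ^^ j) b" for j a b
    using that
  proof (induction j arbitrary: a b)
    case (Suc j)
    have "(shift_map ^^ m) ((\<Phi> ^^ j) a) = (shift_map ^^ m) ((\<Phi> ^^ j) b)"
      using Suc.prems by (intro m) (auto simp: Phi_pow_in)
    then have "(\<Phi> ^^ j) ((shift_map ^^ m) a) = (\<Phi> ^^ j) ((shift_map ^^ m) b)"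
      using Suc.prems by (simp add: Phi_pow_shift_pow)
    from Suc.IH[OF shift_pow shift_pow this] Suc.prems
    have "(shift_map ^^ (j * m + m)) a = (shift_map ^^ (j * m + m)) b" by (simp add: funpow_add)
    then show ?case by (simp add: add.commute)
  qed simp
  have "(shift_map ^^ (J * m)) a = (shift_map ^^ (J * m)) b"
    if "j \<le> J" "a \<in> X" "b \<in> X" "(\<Phi> ^^ j) a = (\<Phi> ^^ j) b" for j a b
  proof -
    have "J * m = (J - j) * m + j * m" using that(1) by (simp add: add_mult_distrib[symmetric])
    then show ?thesis using pow[OF that(2-4)] by (simp add: funpow_add)
  qed
  then show ?thesis by blast
qed

section \<open>Roots of powers of the shift\<close>

text \<open>Each coordinate of the identity depends on finitely many letters, and every prefix of
  \<open>x\<close> occurs in \<open>y\<close>.\<close>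

lemma eventual_agreement_propagates:
  assumes y: "y \<in> X" and eq: "(shift_map ^^ p) y = (shift_map ^^ q) ((\<Phi> ^^ k) y)" and x: "x \<in> X"
  shows "(shift_map ^^ p) x = (shift_map ^^ q) ((\<Phi> ^^ k) x)"
proof
  fix i
  \<comment> \<open>Long enough to show the coordinates \<open>i + p\<close> and
    \<open>i + q\<close>; the extra \<open>k * r\<close> letters below pay for
    \<open>\<Phi> ^^ k\<close>.\<close>
  define R where "R = Suc (i + p + q)"
  obtain t where t: "pre (R + k * r) ((shift_map ^^ t) y) = pre (R + k * r) x"
    using rec0[OF y x] by blast
  then have "pre R ((shift_map ^^ t) ((\<Phi> ^^ k) y)) = pre R ((\<Phi> ^^ k) x)"
    using pre_Phi_pow[OF shift_pow[OF y] x t] y by (simp add: Phi_pow_shift_pow)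
  then have "(\<Phi> ^^ k) x (i + q) = (\<Phi> ^^ k) y (i + q + t)"
    by (auto simp: pre_eq_iff shift_map_funpow R_def)
  also have "\<dots> = y (i + t + p)"
    using fun_cong[OF eq, of "i + t"] by (simp add: shift_map_funpow add_ac)
  also have "y (i + t + p) = y (i + p + t)" by (simp add: add_ac)
  also have "\<dots> = x (i + p)"
    using t by (simp add: pre_eq_iff shift_map_funpow R_def)
  finally show "(shift_map ^^ p) x i = (shift_map ^^ q) ((\<Phi> ^^ k) x) i"
    by (simp add: shift_map_funpow)
qed

theorem Phi_root_of_shift_power:
  "\<exists>k n. 0 < k \<and> k \<le> card branch \<and> (\<forall>x\<in>X. (\<Phi> ^^ k) x = (shift_map ^^ n) x)"
proof -
  obtain x y where xy: "x \<in> X" "y \<in> X" "x \<noteq> y" "shift_map x = shift_map y"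
    using branch_nonempty unfolding branch_def by fastforce
  define J where "J = card branch"
  obtain m where m: "\<And>j a b. j \<le> J \<Longrightarrow> a \<in> X \<Longrightarrow> b \<in> X \<Longrightarrow> (\<Phi> ^^ j) a = (\<Phi> ^^ j) b \<Longrightarrow>
      (shift_map ^^ m) a = (shift_map ^^ m) b"
    using Phi_pow_eq_imp_tail_eq[of J] by blast
  \<comment> \<open>The orbits of \<open>a\<close> and \<open>b\<close> are still distinct after
    \<open>m\<close> shifts, so no \<open>\<Phi> ^^ j\<close> with \<open>j \<le> J\<close> can
    identify the two points.\<close>
  obtain a b where ab: "a \<in> X" "b \<in> X" "(shift_map ^^ m) a = x" "(shift_map ^^ m) b = y"
    using shift_pow_onto xy by meson
  have "\<exists>s. (shift_map ^^ s) ((\<Phi> ^^ j) a) \<in> branch" if "j \<le> J" for j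
  proof -
    let ?P = "\<lambda>s. (shift_map ^^ s) ((\<Phi> ^^ j) a) = (shift_map ^^ s) ((\<Phi> ^^ j) b)"
    have "(shift_map ^^ Suc m) a = (shift_map ^^ Suc m) b" using ab xy by simp
    then have P: "?P (Suc m)" using Phi_pow_shift_pow ab by metis
    have P0: "\<not> ?P 0" using m[OF that ab(1,2)] ab xy by auto
    \<comment> \<open>Just before the orbits of the two images merge there are two distinct points
      with the same shift.\<close>
    from ex_least_nat_less[of ?P, OF P P0] obtain s where s: "\<not> ?P s" "?P (Suc s)" by blast
    then have "(shift_map ^^ Suc s) ((\<Phi> ^^ j) a) \<in> branch"
      unfolding branch_def mem_Collect_eq using ab Phi_pow_in shift_pow
      by (intro bexI[of _ "(shift_map ^^ s) ((\<Phi> ^^ j) a)"] bexI[of _ "(shift_map ^^ s) ((\<Phi> ^^ j) b)"]) auto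
    then show ?thesis by blast
  qed
  then obtain s where s: "\<And>j. j \<le> J \<Longrightarrow> (shift_map ^^ s j) ((\<Phi> ^^ j) a) \<in> branch" by metis
  \<comment> \<open>\<open>J + 1\<close> exponents face only \<open>J\<close> branch points.\<close>
  have "\<not> inj_on (\<lambda>j. (shift_map ^^ s j) ((\<Phi> ^^ j) a)) {..J}"
  proof
    assume "inj_on (\<lambda>j. (shift_map ^^ s j) ((\<Phi> ^^ j) a)) {..J}"
    then have "card {..J} \<le> card branch"
      by (rule card_inj_on_le) (use s finite_branch in auto)
    then show False by (simp add: J_def)
  qed
  then obtain i j where ij: "i < j" "j \<le> J"
    "(shift_map ^^ s i) ((\<Phi> ^^ i) a) = (shift_map ^^ s j) ((\<Phi> ^^ j) a)"
    unfolding inj_on_def by (metis atMost_iff linorder_neqE_nat)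
  define k where "k = j - i"
  have k: "0 < k" "k \<le> J" "j = k + i" using ij by (auto simp: k_def)
  define p q where "p = s i" and "q = s j"
  have "(shift_map ^^ p) ((\<Phi> ^^ i) a) = (shift_map ^^ q) ((\<Phi> ^^ k) ((\<Phi> ^^ i) a))"
    using ij(3) by (simp add: p_def q_def k(3) funpow_add)
  from eventual_agreement_propagates[OF Phi_pow_in[OF ab(1)] this]
  have agree: "(shift_map ^^ p) v = (shift_map ^^ q) ((\<Phi> ^^ k) v)" if "v \<in> X" for v
    using that by blast
  \<comment> \<open>Otherwise the shift map would have a left inverse on \<open>X\<close>.\<close>
  have "q \<le> p"
  proof (rule ccontr)
    assume "\<not> q \<le> p"
    then obtain d where d: "q = Suc d + p" by (metis add.commute less_imp_Suc_add not_le add_Suc)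
    have id: "w = (shift_map ^^ d) ((\<Phi> ^^ k) (shift_map w))" if "w \<in> X" for w
    proof -
      obtain v where v: "v \<in> X" "(shift_map ^^ p) v = w" using shift_pow_onto \<open>w \<in> X\<close> by blast
      have "w = (shift_map ^^ Suc d) ((shift_map ^^ p) ((\<Phi> ^^ k) v))"
        using agree[OF v(1)] v(2) by (simp add: d funpow_add)
      also have "\<dots> = (shift_map ^^ d) (shift_map ((\<Phi> ^^ k) w))"
        using v Phi_pow_shift_pow[OF v(1), of k p] by (simp add: funpow_swap1)
      also have "shift_map ((\<Phi> ^^ k) w) = (\<Phi> ^^ k) (shift_map w)"
        using Phi_pow_shift_pow[OF that, of k 1] by simp
      finally show ?thesis .
    qed
    show False using id[OF xy(1)] id[OF xy(2)] xy by simp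
  qed
  have "(\<Phi> ^^ k) w = (shift_map ^^ (p - q)) w" if "w \<in> X" for w
  proof -
    obtain v where v: "v \<in> X" "(shift_map ^^ q) v = w" using shift_pow_onto \<open>w \<in> X\<close> by blast
    have "(\<Phi> ^^ k) w = (shift_map ^^ p) v" using v agree Phi_pow_shift_pow by metis
    also have "\<dots> = (shift_map ^^ (p - q + q)) v" using \<open>q \<le> p\<close> by simp
    finally show ?thesis using v by (simp add: funpow_add)
  qed
  then show ?thesis using k by (auto simp: J_def)
qed

end

section \<open>Linearly recurrent shifts\<close>

text \<open>A basic open set restricts finitely many coordinates, so it contains the cylinder of a
  sufficiently long prefix of each of its points; conversely, cylinders are basic open sets.\<close>

lemma openin_full_shift:
  "openin (full_shift_topology A) U \<longleftrightarrow>
     (\<forall>x\<in>U. range x \<subseteq> A \<and> (\<exists>n. \<forall>y. range y \<subseteq> A \<and> pre n y = pre n x \<longrightarrow> y \<in> U))"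
  (is "_ \<longleftrightarrow> ?R")
proof
  assume U: "openin (full_shift_topology A) U"
  show ?R
  proof
    fix x assume "x \<in> U"
    then obtain V where V: "finite {i. V i \<noteq> A}" "\<And>i. V i \<subseteq> A" "x \<in> Pi\<^sub>E UNIV V" "Pi\<^sub>E UNIV V \<subseteq> U"
      using U unfolding full_shift_topology_def openin_product_topology_alt by fastforce
    obtain n where n: "\<And>i. V i \<noteq> A \<Longrightarrow> i < n"
      using V(1) finite_nat_set_iff_bounded by auto
    have "y \<in> U" if y: "range y \<subseteq> A" "pre n y = pre n x" for y
    proof -
      have "y i \<in> V i" for i
      proof (cases "V i = A")
        case True
        then show ?thesis using y by auto
      next
        case False
        then have "y i = x i" using n y by (simp add: pre_eq_iff)
        then show ?thesis using V(3) by auto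
      qed
      then show ?thesis using V(4) by auto
    qed
    moreover have "range x \<subseteq> A" using V by auto
    ultimately show "range x \<subseteq> A \<and> (\<exists>n. \<forall>y. range y \<subseteq> A \<and> pre n y = pre n x \<longrightarrow> y \<in> U)" by blast
  qed
next
  assume R: ?R
  show "openin (full_shift_topology A) U"
    unfolding full_shift_topology_def openin_product_topology_alt
  proof
    fix x assume "x \<in> U"
    with R have "range x \<subseteq> A" "\<exists>n. \<forall>y. range y \<subseteq> A \<and> pre n y = pre n x \<longrightarrow> y \<in> U" by blast+
    then obtain n where n: "range x \<subseteq> A" "\<forall>y. range y \<subseteq> A \<and> pre n y = pre n x \<longrightarrow> y \<in> U"
      by blast
    define V where "V i = (if i < n then {x i} else A)" for i
    have "{i. V i \<noteq> A} \<subseteq> {..<n}" by (auto simp: V_def)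
    then have "finite {i. V i \<noteq> A}" by (rule finite_subset) simp
    moreover have "V i \<subseteq> A" for i using n(1) by (auto simp: V_def)
    moreover have "x \<in> Pi\<^sub>E UNIV V" using n(1) by (auto simp: V_def)
    moreover have "Pi\<^sub>E UNIV V \<subseteq> U"
    proof
      fix y assume "y \<in> Pi\<^sub>E UNIV V"
      then have yV: "y i \<in> V i" for i by auto
      have "range y \<subseteq> A" using yV \<open>\<And>i. V i \<subseteq> A\<close> by blast
      moreover have "y i = x i" if "i < n" for i using yV[of i] that by (simp add: V_def)
      ultimately show "y \<in> U" using n(2) by (simp add: pre_eq_iff)
    qed
    ultimately show "\<exists>V. finite {i \<in> UNIV. V i \<noteq> topspace (discrete_topology A)} \<and>
        (\<forall>i\<in>UNIV. openin (discrete_topology A) (V i)) \<and> x \<in> Pi\<^sub>E UNIV V \<and> Pi\<^sub>E UNIV V \<subseteq> U"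
      by (intro exI[of _ V]) auto
  qed
qed

lemma topspace_full_shift: "topspace (full_shift_topology A) = {x. range x \<subseteq> A}"
  by (auto simp: full_shift_topology_def PiE_def Pi_def)

lemma closedin_full_shift:
  "closedin (full_shift_topology A) Y \<longleftrightarrow>
     (\<forall>y\<in>Y. range y \<subseteq> A) \<and> (\<forall>x. (\<forall>n. \<exists>y\<in>Y. pre n y = pre n x) \<longrightarrow> x \<in> Y)"
  (is "_ \<longleftrightarrow> ?sub \<and> ?lim")
proof
  assume cl: "closedin (full_shift_topology A) Y"
  then have "Y \<subseteq> {x. range x \<subseteq> A}" using closedin_subset topspace_full_shift by metis
  then have sub: ?sub by blast
  have "x \<in> Y" if lim: "\<forall>n. \<exists>y\<in>Y. pre n y = pre n x" for x
  proof (rule ccontr)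
    assume "x \<notin> Y"
    have "x i \<in> A" for i
    proof -
      obtain y where "y \<in> Y" "pre (Suc i) y = pre (Suc i) x" using lim by blast
      moreover from this have "y i = x i" by (simp add: pre_eq_iff)
      ultimately show ?thesis using sub by (metis rangeI subsetD)
    qed
    then have "x \<in> topspace (full_shift_topology A) - Y"
      using \<open>x \<notin> Y\<close> by (auto simp: topspace_full_shift)
    moreover have "openin (full_shift_topology A) (topspace (full_shift_topology A) - Y)"
      using cl by blast
    ultimately obtain n where "\<And>y. range y \<subseteq> A \<Longrightarrow> pre n y = pre n x \<Longrightarrow> y \<notin> Y"
      unfolding openin_full_shift by blast
    then show False using lim sub by blast
  qed
  then show "?sub \<and> ?lim" using sub by blast
next
  assume R: "?sub \<and> ?lim"
  have "openin (full_shift_topology A) ({x. range x \<subseteq> A} - Y)"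
    unfolding openin_full_shift
  proof
    fix x assume x: "x \<in> {x. range x \<subseteq> A} - Y"
    then have "\<not> (\<forall>n. \<exists>y\<in>Y. pre n y = pre n x)" using R by fast
    then obtain n where "\<forall>y\<in>Y. pre n y \<noteq> pre n x" by blast
    then show "range x \<subseteq> A \<and>
        (\<exists>n. \<forall>y. range y \<subseteq> A \<and> pre n y = pre n x \<longrightarrow> y \<in> {x. range x \<subseteq> A} - Y)"
      using x by blast
  qed
  then show "closedin (full_shift_topology A) Y"
    using R by (auto simp: closedin_def topspace_full_shift)
qed

lemma shift_endomorphism_locally_constant:
  assumes "one_sided_shift A X" "shift_endomorphism A X \<Phi>" "z \<in> X"
  shows "\<exists>n. \<forall>x\<in>X. pre n x = pre n z \<longrightarrow> \<Phi> x 0 = \<Phi> z 0"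
proof -
  let ?T = "subtopology (full_shift_topology A) X"
  \<comment> \<open>\<open>V\<close> is the cylinder of the letter \<open>\<Phi> z 0\<close>. Its
    preimage is open, hence contains all points of \<open>X\<close> sharing a long enough prefix
    with \<open>z\<close>.\<close>
  define V where "V = {y :: nat \<Rightarrow> 'a. range y \<subseteq> A \<and> y 0 = \<Phi> z 0}"
  have XA: "\<forall>x\<in>X. range x \<subseteq> A"
    using assms(1) by (simp add: one_sided_shift_def closedin_full_shift)
  then have top: "topspace ?T = X" by (auto simp: topspace_full_shift)
  have "openin (full_shift_topology A) V"
    unfolding openin_full_shift V_def
    by (auto simp: pre_eq_iff intro!: exI[of _ "1::nat"])
  then have "openin ?T (X \<inter> V)" by (auto simp: openin_subtopology)
  then have "openin ?T {x \<in> topspace ?T. \<Phi> x \<in> X \<inter> V}"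
    using assms(2) unfolding shift_endomorphism_def continuous_map_def by blast
  then obtain U where U: "openin (full_shift_topology A) U" "{x \<in> X. \<Phi> x \<in> X \<inter> V} = U \<inter> X"
    unfolding top openin_subtopology by blast
  have PhiX: "\<Phi> z \<in> X" using assms(2,3) by (auto simp: shift_endomorphism_def)
  then have "z \<in> U" using U(2) assms(3) XA by (auto simp: V_def)
  then obtain n where n: "\<And>y. range y \<subseteq> A \<Longrightarrow> pre n y = pre n z \<Longrightarrow> y \<in> U"
    using U(1) unfolding openin_full_shift by blast
  have "\<Phi> x 0 = \<Phi> z 0" if "x \<in> X" "pre n x = pre n z" for x
  proof -
    have "x \<in> U \<inter> X" using n that XA by blast
    then show ?thesis using U(2) by (auto simp: V_def)
  qed
  then show ?thesis by blast
qed

section \<open>From return words to recurrence windows\<close>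

lemma pre_in_language: "x \<in> X \<Longrightarrow> map x [i..<i + n] \<in> language X"
  by (auto simp: language_def)

lemma shift_map_funpow_in: "one_sided_shift A X \<Longrightarrow> x \<in> X \<Longrightarrow> (shift_map ^^ m) x \<in> X"
  by (induction m) (auto simp: one_sided_shift_def)

text \<open>The points of \<open>X\<close> in which the word \<open>pre n z\<close> never occurs
  form a subshift missing \<open>z\<close>, which is empty by minimality. This is applied to
  \<open>(shift_map ^^ t) x\<close>.\<close>

lemma minimal_shift_recurs:
  assumes min: "minimal_shift A X" and x: "x \<in> X" and z: "z \<in> X"
  shows "\<exists>j\<ge>t. pre n ((shift_map ^^ j) x) = pre n z"
proof -
  define Y where "Y = {y \<in> X. \<forall>j. pre n ((shift_map ^^ j) y) \<noteq> pre n z}"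
  have X: "one_sided_shift A X" using min by (simp add: minimal_shift_def)
  have "one_sided_shift A Y"
    unfolding one_sided_shift_def closedin_full_shift
  proof (intro conjI ballI allI impI)
    show "finite A" using X by (simp add: one_sided_shift_def)
    show "range y \<subseteq> A" if "y \<in> Y" for y
      using that X by (auto simp: Y_def one_sided_shift_def closedin_full_shift)
    show "y \<in> Y" if lim: "\<forall>n. \<exists>y'\<in>Y. pre n y' = pre n y" for y
    proof -
      have "\<forall>n. \<exists>y'\<in>X. pre n y' = pre n y" using lim unfolding Y_def by blast
      then have "y \<in> X" using X by (simp add: one_sided_shift_def closedin_full_shift)
      moreover have "pre n ((shift_map ^^ j) y) \<noteq> pre n z" for j
      proof -
        obtain y' where "y' \<in> Y" "pre (n + j) y' = pre (n + j) y" using lim by blast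
        then have "pre n ((shift_map ^^ j) y') = pre n ((shift_map ^^ j) y)"
          by (simp add: pre_eq_iff shift_map_funpow)
        then show ?thesis using \<open>y' \<in> Y\<close> by (auto simp: Y_def)
      qed
      ultimately show ?thesis by (simp add: Y_def)
    qed
    show "shift_map ` Y \<subseteq> Y"
    proof safe
      fix y assume "y \<in> Y"
      moreover have "(shift_map ^^ j) (shift_map y) = (shift_map ^^ Suc j) y" for j
        by (simp add: funpow_swap1)
      ultimately show "shift_map y \<in> Y"
        using X by (auto simp: Y_def one_sided_shift_def simp del: funpow.simps)
    qed
  qed
  moreover have "z \<notin> Y" by (auto simp: Y_def intro!: exI[of _ 0])
  ultimately have "Y = {}" using min z by (auto simp: minimal_shift_def Y_def)
  then have "(shift_map ^^ t) x \<notin> Y" by simp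
  then obtain j where "pre n ((shift_map ^^ j) ((shift_map ^^ t) x)) = pre n z"
    using shift_map_funpow_in[OF X x] by (auto simp: Y_def)
  then show ?thesis by (intro exI[of _ "j + t"]) (simp add: funpow_add)
qed

text \<open>The assumption \<open>i + n \<le> j\<close> is what makes \<open>u\<close> a prefix of
  the word between the occurrences, as clause (a) demands.\<close>

lemma consecutive_occurrences_return_word:
  assumes x: "x \<in> X" and ij: "i + n \<le> j"
    and occ: "pre n ((shift_map ^^ i) x) = u" "pre n ((shift_map ^^ j) x) = u"
    and between: "\<And>k. i < k \<Longrightarrow> k < j \<Longrightarrow> pre n ((shift_map ^^ k) x) \<noteq> u"
    and n: "0 < n"
  shows "return_word X u (map x [i..<j])"
proof -
  have u: "pre n ((shift_map ^^ k) x) = map x [k..<k + n]" for k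
    by (rule nth_equalityI) (simp_all add: pre_def shift_map_funpow add.commute)
  have len: "length u = n" using occ by auto
  have ui: "u = map x [i..<i + n]" and uj: "u = map x [j..<j + n]" using occ u by auto
  have wu: "map x [i..<j] @ u = map x [i..<j + n]"
    using ij unfolding uj map_append[symmetric] by (subst upt_add_eq_append) auto
  have "[i..<j] = [i..<i + n] @ [i + n..<j]"
    using ij upt_add_eq_append[of i "i + n" "j - (i + n)"] by simp
  then have "prefix u (map x [i..<j])" unfolding ui by simp
  moreover have "u \<in> language X" unfolding ui by (rule pre_in_language[OF x])
  moreover have "map x [i..<j] \<in> language X" using pre_in_language[OF x, of i "j - i"] ij by simp
  moreover have "map x [i..<j] @ u \<in> language X"
    unfolding wu using pre_in_language[OF x, of i "j + n - i"] ij by simp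
  moreover have "occurrences u (map x [i..<j] @ u) = {0, j - i}"
  proof -
    have "take n (drop k (map x [i..<j + n])) = pre n ((shift_map ^^ (i + k)) x)" if "k + n \<le> j + n - i" for k
      unfolding u using that ij by (simp add: drop_map take_map add_ac)
    then have "occurrences u (map x [i..<j] @ u) =
        {k. k \<le> j - i \<and> pre n ((shift_map ^^ (i + k)) x) = u}"
      unfolding wu occurrences_def len using ij by auto
    also have "\<dots> = {0, j - i}"
    proof (intro equalityI subsetI)
      fix k assume k: "k \<in> {k. k \<le> j - i \<and> pre n ((shift_map ^^ (i + k)) x) = u}"
      then show "k \<in> {0, j - i}" using between[of "i + k"] ij by fastforce
    qed (use occ ij in auto)
    finally show ?thesis .
  qed
  then have "card (occurrences u (map x [i..<j] @ u)) = 2" using ij n by simp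
  ultimately show ?thesis by (simp add: return_word_def)
qed

text \<open>By clause (a), return words to \<open>u\<close> are at least as long as \<open>u\<close>, so the recurrence constant
  says nothing about overlapping consecutive occurrences; hence \<open>max K 1\<close>.\<close>

lemma linearly_recurrent_window:
  assumes lin: "linearly_recurrent A X K" and x: "x \<in> X" and z: "z \<in> X" and n: "0 < n"
  shows "\<exists>j\<ge>t. real j + 1 \<le> real t + max K 1 * real n \<and> pre n ((shift_map ^^ j) x) = pre n z"
proof -
  have min: "minimal_shift A X" using lin by (simp add: linearly_recurrent_def)
  have X: "one_sided_shift A X" using min by (simp add: minimal_shift_def)
  define occ where "occ k \<longleftrightarrow> pre n ((shift_map ^^ k) x) = pre n z" for k
  \<comment> \<open>A prefix of length \<open>M\<close> contains every word of length
    \<open>n\<close> that starts within the window.\<close>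
  define M where "M = n + nat \<lceil>max K 1 * real n\<rceil>"
  obtain i0 where i0: "occ i0" using minimal_shift_recurs[OF min x z, of 0 n] by (auto simp: occ_def)
  \<comment> \<open>No occurrence need precede \<open>t\<close>, so the window is moved to a later
    copy at \<open>q\<close>, to the right of \<open>i0\<close>. Consecutive occurrences
    \<open>i < q \<le> j\<close> then bound the distance from \<open>q\<close> to
    \<open>j\<close>.\<close>
  obtain q where q: "q \<ge> Suc i0" "pre M ((shift_map ^^ q) x) = pre M ((shift_map ^^ t) x)"
    using minimal_shift_recurs[OF min x shift_map_funpow_in[OF X x]] by blast
  define j where "j = (LEAST k. q \<le> k \<and> occ k)"
  have ex: "\<exists>k. q \<le> k \<and> occ k" using minimal_shift_recurs[OF min x z] by (simp add: occ_def)
  have j: "q \<le> j" "occ j" using LeastI_ex[OF ex] by (auto simp: j_def)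
  have jleast: "j \<le> k" if "q \<le> k" "occ k" for k using that by (simp add: j_def Least_le)
  define i where "i = (GREATEST k. k < q \<and> occ k)"
  have i: "i < q \<and> occ i"
    unfolding i_def by (rule GreatestI_nat[of _ i0 q]) (use i0 q in auto)
  have igreat: "k \<le> i" if "k < q" "occ k" for k
    unfolding i_def by (rule Greatest_le_nat[of _ k q]) (use that in auto)
  have between: "\<not> occ k" if "i < k" "k < j" for k
    using that igreat[of k] jleast[of k] by (cases "k < q") auto
  have gap: "real (j - i) \<le> max K 1 * real n"
  proof (cases "i + n \<le> j")
    case True
    have "return_word X (pre n z) (map x [i..<j])"
      using consecutive_occurrences_return_word[OF x True _ _ _ n] i j between
      unfolding occ_def by blast
    moreover from this have "pre n z \<in> language X" by (simp add: return_word_def)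
    moreover have "pre n z \<noteq> []" using n by (metis length_pre less_irrefl list.size(3))
    ultimately have "real (length (map x [i..<j])) \<le> K * real (length (pre n z))"
      using lin unfolding linearly_recurrent_def by blast
    also have "\<dots> \<le> max K 1 * real n" by (simp add: mult_right_mono)
    finally show ?thesis by simp
  next
    case False
    then have "real (j - i) \<le> 1 * real n" by simp
    also have "\<dots> \<le> max K 1 * real n" by (intro mult_right_mono) auto
    finally show ?thesis .
  qed
  define d where "d = j - q"
  \<comment> \<open>The strict inequality \<open>i < q\<close> supplies the
    \<open>+ 1\<close>.\<close>
  have d: "real d + 1 \<le> max K 1 * real n" using gap i j by (simp add: d_def)
  then have "d + n \<le> M" unfolding M_def by linarith
  have "pre n ((shift_map ^^ (t + d)) x) = pre n ((shift_map ^^ j) x)"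
    unfolding pre_eq_iff shift_map_funpow
  proof (intro allI impI)
    fix s assume "s < n"
    then have "x (s + d + q) = x (s + d + t)"
      using q(2) \<open>d + n \<le> M\<close> by (simp add: pre_eq_iff shift_map_funpow)
    moreover have "s + d + q = s + j" "s + d + t = s + (t + d)" using j by (simp_all add: d_def)
    ultimately show "x (s + (t + d)) = x (s + j)" by metis
  qed
  then show ?thesis using d j by (intro exI[of _ "t + d"]) (auto simp: occ_def)
qed

lemma linearly_recurrent_recurrent_shift:
  assumes "linearly_recurrent A X K" "infinite X"
  shows "recurrent_shift A X (max K 1)"
proof -
  have X: "finite A" "closedin (full_shift_topology A) X" "shift_map ` X \<subseteq> X"
    using assms(1) by (auto simp: linearly_recurrent_def minimal_shift_def one_sided_shift_def)
  have XA: "range x \<subseteq> A" if "x \<in> X" for x using X(2) that by (simp add: closedin_full_shift)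
  show ?thesis
  proof
    show "x i \<in> A" if "x \<in> X" for x i using XA[OF that] by blast
    show "x \<in> X" if "\<And>n. \<exists>y\<in>X. pre n y = pre n x" for x
      using X(2) that by (simp add: closedin_full_shift)
    show "\<exists>j\<ge>t. real j + 1 \<le> real t + max K 1 * real n \<and> pre n ((shift_map ^^ j) x) = pre n z"
      if "x \<in> X" "z \<in> X" "0 < n" for x z n t
      using linearly_recurrent_window[OF assms(1) that] .
  qed (use X assms(2) in auto)
qed

theorem theorem2p5:
  fixes A :: "'a set" and X :: "(nat \<Rightarrow> 'a) set" and K :: real
    and \<Phi> :: "(nat \<Rightarrow> 'a) \<Rightarrow> nat \<Rightarrow> 'a"
  assumes "one_sided_shift A X"
    and "infinite X"
    and "minimal_shift A X"
    and "linearly_recurrent A X K"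
    and "shift_endomorphism A X \<Phi>"
  shows "\<exists>k n :: nat. 0 < k \<and> real k \<le> 2 * (K + 1) * (2 * K + 3)^2 \<and>
           (\<forall>x\<in>X. (\<Phi> ^^ k) x = (shift_map ^^ n) x)"
proof -
  interpret recurrent_shift A X "max K 1"
    using linearly_recurrent_recurrent_shift assms by blast
  obtain r where r: "\<And>x y. x \<in> X \<Longrightarrow> y \<in> X \<Longrightarrow> pre r x = pre r y \<Longrightarrow> \<Phi> x 0 = \<Phi> y 0"
    using uniformly_locally_constant[of "\<lambda>x. \<Phi> x 0"]
      shift_endomorphism_locally_constant[OF assms(1,5)] by blast
  interpret recurrent_shift_endomorphism A X "max K 1" \<Phi> r
  proof
    show "\<Phi> x 0 = \<Phi> y 0" if "x \<in> X" "y \<in> X" "pre (Suc r) x = pre (Suc r) y" for x y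
      by (rule r[OF that(1,2)]) (rule pre_eq_mono[OF that(3)], simp)
  qed (use assms(5) in \<open>auto simp: shift_endomorphism_def\<close>)
  obtain k n where k: "0 < k" "k \<le> card branch" "\<forall>x\<in>X. (\<Phi> ^^ k) x = (shift_map ^^ n) x"
    using Phi_root_of_shift_power by blast
  \<comment> \<open>From \<open>2 \<le> max K 1\<close> it follows that the maximum is
    \<open>K\<close>.\<close>
  have K: "2 \<le> K" using c_ge_2 by (simp add: max_def split: if_splits)
  \<comment> \<open>The number of branch points gives \<open>k \<le> K\<close>; the rest weakens
    this to the stated bound.\<close>
  have "real k \<le> K" using k(2) card_branch K by simp
  also have "K \<le> 2 * (K + 1) * 1" using K by simp
  also have "\<dots> \<le> 2 * (K + 1) * (2 * K + 3)^2" using K by (intro mult_left_mono) auto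
  finally show ?thesis using k by blast
qed

end
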